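(* Let $p,q\ge 2$ be relatively prime integers and let $\omega_j=e^{2\pi i j/p}$. Then $$\sum_{\substack{n=1\\ p\nmid n,\ q\nmid n}}^{pq-1}\frac{\cot(\pi n/p)\cot(\pi n/q)}{\sin^2(\pi n/(pq))}=\frac{1}{45p}\left(p^4q^3-5p^4q+4q^3-5p^2q^3+55p^2q+30p^2-50q-30\right)+\frac{32}{p}\sum_{j=1}^{p-1}\frac{\omega_j}{(\omega_j-1)^3(\omega_j^q-1)}+\frac{32q}{p}\sum_{j=1}^{p-1}\frac{\omega_j}{(\omega_j-1)^2(\omega_j^q-1)^2}.$$ *)

theory Defs
  imports "HOL-Analysis.Analysis"
begin

end

theory Submission
  imports Defs
begin

text \<open>
  With \<open>C x = (x + 1) / (x - 1)\<close>, \<open>K x = 4 x / (x - 1)\<^sup>2 = C(x)\<^sup>2 - 1\<close> and \<open>z = exp (2 \<pi> i n / (p q))\<close>,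
  the left-hand side is the sum of \<open>K(z) C(z^p) C(z^q)\<close> over \<open>z = s w\<close>, where \<open>s\<close> and \<open>w\<close> are
  \<open>p\<close>-th and \<open>q\<close>-th roots of unity. The distribution relation \<open>p C(z^p) = \<Sum>\<^sub>u C(z u)\<close> over
  \<open>u^p = 1\<close> and the addition law
  \<open>K(z) C(z u) = K(u) (C(z u) - C(z)) + C(u) K(z)\<close> make every term linear in functions of \<open>w\<close>,
  so the sum over \<open>w\<close> is given by distribution relations of order \<open>q\<close>. The remaining double
  sums over \<open>p\<close>-th roots collapse by the cotangent addition law, and parity under
  \<open>u \<mapsto> 1/u\<close> turns the surviving single sums into the two sums of the theorem.
\<close>

text \<open>Division by zero makes both functions vanish at 1, so that sums over roots of unity
  need not exclude the poles.\<close>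

definition cayley :: "complex \<Rightarrow> complex" where
  "cayley x = (x + 1) / (x - 1)"

definition koebe :: "complex \<Rightarrow> complex" where
  "koebe x = 4 * x / (x - 1)\<^sup>2"

definition unity_roots :: "nat \<Rightarrow> complex set" where
  "unity_roots n = {z. z ^ n = 1}"

lemma cayley_1 [simp]: "cayley 1 = 0"
  by (simp add: cayley_def)

lemma koebe_1 [simp]: "koebe 1 = 0"
  by (simp add: koebe_def)

section \<open>Parity and addition laws for \<open>cayley\<close> and \<open>koebe\<close>\<close>

lemma cayley_inverse: "x \<noteq> 0 \<Longrightarrow> cayley (inverse x) = - cayley x"
  by (cases "x = 1") (auto simp: cayley_def divide_simps, simp add: algebra_simps)

lemma koebe_inverse: "x \<noteq> 0 \<Longrightarrow> koebe (inverse x) = koebe x"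
  by (cases "x = 1") (auto simp: koebe_def divide_simps power2_eq_square, simp add: algebra_simps)

lemma koebe_eq: "x \<noteq> 1 \<Longrightarrow> koebe x = (cayley x)\<^sup>2 - 1"
  by (simp add: koebe_def cayley_def divide_simps power2_eq_square) (simp add: algebra_simps)

lemma cayley_eq: "x \<noteq> 1 \<Longrightarrow> cayley x = 1 + 2 * (1 / (x - 1))"
  by (simp add: cayley_def divide_simps)

lemma koebe_eq_inverse: "koebe x = 4 * x * (1 / (x - 1))\<^sup>2"
  by (simp add: koebe_def power_divide)

text \<open>Cotangent addition law: at \<open>cis (2 * t)\<close>, \<open>cayley\<close> is
  \<open>- \<i> * cot t\<close>. Its use is to turn a product into something linear in functions of
  \<open>x\<close> once \<open>\<xi>\<close> is fixed.\<close>

lemma cayley_times_cayley: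
  assumes "x \<noteq> 1" "\<xi> \<noteq> 1" "x * \<xi> \<noteq> 1"
  shows "cayley x * cayley (x * \<xi>) = 1 + cayley \<xi> * (cayley x - cayley (x * \<xi>))"
  using assms by (simp add: cayley_def divide_simps) algebra

text \<open>Replace \<open>koebe x\<close> by \<open>(cayley x)\<^sup>2 - 1\<close> and apply the
  addition law twice; the coefficient \<open>1 - (cayley \<xi>)\<^sup>2\<close> that appears is
  \<open>- koebe \<xi>\<close>.\<close>

lemma koebe_times_cayley:
  assumes "x \<noteq> 1" "\<xi> \<noteq> 1" "x * \<xi> \<noteq> 1"
  shows "koebe x * cayley (x * \<xi>) =
    koebe \<xi> * (cayley (x * \<xi>) - cayley x) + cayley \<xi> * koebe x"
  using cayley_times_cayley[OF assms] unfolding koebe_eq[OF assms(1)] koebe_eq[OF assms(2)]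
  by algebra

text \<open>No condition \<open>sin t \<noteq> 0\<close> is imposed: at such \<open>t\<close> both
  sides are 0, because the division-by-zero values of \<open>cot\<close>, \<open>cayley\<close> and
  \<open>koebe\<close> agree.\<close>

lemma cayley_cis: "\<i> * cayley (cis (2 * t)) = complex_of_real (cot t)"
  and koebe_cis: "- koebe (cis (2 * t)) = complex_of_real (1 / (sin t)\<^sup>2)"
proof -
  have d: "cis (2 * t) = cis t * cis t"
    by (simp add: cis_mult)
  have inv: "cis t * cis (- t) = 1"
    by (simp add: cis_mult)
  have c: "cis t + cis (-t) = 2 * of_real (cos t)" and s: "cis t - cis (-t) = 2 * \<i> * of_real (sin t)"
    by (auto simp: complex_eq_iff)
  have plus: "cis (2 * t) + 1 = 2 * of_real (cos t) * cis t"
    unfolding d c[symmetric] using inv by algebra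
  have minus: "cis (2 * t) - 1 = 2 * \<i> * of_real (sin t) * cis t"
    unfolding d s[symmetric] using inv by algebra
  show "\<i> * cayley (cis (2 * t)) = complex_of_real (cot t)"
    unfolding cayley_def plus minus by (simp add: cot_def)
  show "- koebe (cis (2 * t)) = complex_of_real (1 / (sin t)\<^sup>2)"
    unfolding koebe_def minus unfolding d by (simp add: power_mult_distrib flip: power2_eq_square)
qed

section \<open>Roots of unity and reindexing of sums over them\<close>

lemma finite_unity_roots: "n > 0 \<Longrightarrow> finite (unity_roots n)"
  unfolding unity_roots_def using finite_roots_unity[of n] by simp

lemma card_unity_roots: "n > 0 \<Longrightarrow> card (unity_roots n) = n"
  unfolding unity_roots_def using card_roots_unity_eq[of n] by simp

lemma one_in_unity_roots [simp]: "1 \<in> unity_roots n"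
  by (simp add: unity_roots_def)

lemma unity_roots_nonzero: "n > 0 \<Longrightarrow> u \<in> unity_roots n \<Longrightarrow> u \<noteq> 0"
  by (auto simp: unity_roots_def power_0_left)

lemma unity_roots_mult: "u \<in> unity_roots n \<Longrightarrow> v \<in> unity_roots n \<Longrightarrow> u * v \<in> unity_roots n"
  by (simp add: unity_roots_def power_mult_distrib)

lemma unity_roots_inverse: "u \<in> unity_roots n \<Longrightarrow> inverse u \<in> unity_roots n"
  by (simp add: unity_roots_def power_inverse)

lemma unity_roots_power: "u \<in> unity_roots n \<Longrightarrow> u ^ k \<in> unity_roots n"
  by (simp add: unity_roots_def) (metis mult.commute power_mult power_one)

lemma sum_unity_roots_inverse:
  "(\<Sum>u\<in>unity_roots n. f (inverse u)) = (\<Sum>u\<in>unity_roots n. f u)"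
  by (rule sum.reindex_bij_witness[of _ inverse inverse]) (auto intro: unity_roots_inverse)

lemma sum_unity_roots_shift:
  assumes "n > 0" "v \<in> unity_roots n"
  shows "(\<Sum>u\<in>unity_roots n. f (u * v)) = (\<Sum>u\<in>unity_roots n. f u)"
  using unity_roots_nonzero[OF assms] assms(2)
  by (intro sum.reindex_bij_witness[of _ "\<lambda>u. u * inverse v" "\<lambda>u. u * v"])
    (auto intro: unity_roots_inverse unity_roots_mult)

text \<open>Inversion permutes the roots, so the sum equals its own negative.\<close>

lemma sum_unity_roots_odd:
  fixes f :: "complex \<Rightarrow> complex"
  assumes "\<And>u. u \<in> unity_roots n \<Longrightarrow> f (inverse u) = - f u"
  shows "(\<Sum>u\<in>unity_roots n. f u) = 0"
proof -
  have "(\<Sum>u\<in>unity_roots n. f u) = (\<Sum>u\<in>unity_roots n. - f u)"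
    using sum_unity_roots_inverse[of f n] assms by simp
  thus ?thesis by (simp add: sum_negf)
qed

lemma unity_roots_coprime:
  assumes "coprime m n" "u \<in> unity_roots m" "u \<in> unity_roots n"
  shows "u = 1"
proof (cases "m = 0")
  case True
  \<comment> \<open>Here \<open>coprime 0 n\<close> forces \<open>n = 1\<close>.\<close>
  then show ?thesis using assms by (simp add: unity_roots_def)
next
  case False
  then obtain x y where xy: "m * x = n * y + gcd m n" using bezout_nat by blast
  have "(u ^ m) ^ x = (u ^ n) ^ y * u"
    unfolding power_mult[symmetric] xy using assms(1) by simp
  thus ?thesis using assms by (simp add: unity_roots_def)
qed

text \<open>The kernel of the power map consists of common roots of orders \<open>n\<close> and
  \<open>k\<close>, hence is trivial; injectivity on a finite set gives surjectivity.\<close>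

lemma bij_betw_unity_roots_power:
  assumes "n > 0" "coprime n k"
  shows "bij_betw (\<lambda>u. u ^ k) (unity_roots n) (unity_roots n)"
proof -
  have "inj_on (\<lambda>u. u ^ k) (unity_roots n)"
  proof (rule inj_onI)
    fix u v assume uv: "u \<in> unity_roots n" "v \<in> unity_roots n" "u ^ k = v ^ k"
    note nz = unity_roots_nonzero[OF assms(1) uv(2)]
    have "u * inverse v \<in> unity_roots k"
      using nz uv(3) by (simp add: unity_roots_def power_mult_distrib power_inverse)
    with unity_roots_coprime[OF assms(2)] have "u * inverse v = 1"
      using uv by (auto intro: unity_roots_mult unity_roots_inverse)
    with nz show "u = v" by (simp add: field_simps)
  qed
  moreover have "(\<lambda>u. u ^ k) ` unity_roots n \<subseteq> unity_roots n"
    by (auto intro: unity_roots_power)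
  ultimately show ?thesis
    using finite_unity_roots[OF assms(1)] by (simp add: bij_betw_def endo_inj_surj)
qed

lemma sum_unity_roots_power:
  assumes "n > 0" "coprime n k"
  shows "(\<Sum>u\<in>unity_roots n. f (u ^ k)) = (\<Sum>u\<in>unity_roots n. f u)"
  using sum.reindex_bij_betw[OF bij_betw_unity_roots_power[OF assms]] .

text \<open>Chinese remainder decomposition: coprimality gives injectivity, and comparing
  cardinalities gives surjectivity.\<close>

lemma bij_betw_unity_roots_mult:
  assumes "m > 0" "n > 0" "coprime m n"
  shows "bij_betw (\<lambda>(u, v). u * v) (unity_roots m \<times> unity_roots n) (unity_roots (m * n))"
proof -
  let ?f = "\<lambda>(u, v). u * v :: complex"
  have inj: "inj_on ?f (unity_roots m \<times> unity_roots n)"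
  proof (clarsimp simp: inj_on_def)
    fix a b c d assume *: "a \<in> unity_roots m" "b \<in> unity_roots n" "c \<in> unity_roots m"
      "d \<in> unity_roots n" "a * b = c * d"
    note nz = unity_roots_nonzero[OF assms(1) *(3)] unity_roots_nonzero[OF assms(2) *(2)]
    have eq: "a * inverse c = d * inverse b"
      using nz *(5) by (simp add: field_simps)
    have "a * inverse c = 1"
      using * eq assms(3) by (metis unity_roots_coprime unity_roots_inverse unity_roots_mult)
    with eq nz show "a = c \<and> b = d" by (simp add: field_simps)
  qed
  have sub: "?f ` (unity_roots m \<times> unity_roots n) \<subseteq> unity_roots (m * n)"
    by (auto simp: unity_roots_def power_mult_distrib power_mult)
      (metis mult.commute power_mult power_one)
  have "?f ` (unity_roots m \<times> unity_roots n) = unity_roots (m * n)"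
    by (rule card_subset_eq)
      (use assms sub in \<open>simp_all add: finite_unity_roots card_image[OF inj] card_unity_roots card_cartesian_product\<close>)
  with inj show ?thesis by (simp add: bij_betw_def)
qed

section \<open>Correlations and moments over the \<open>n\<close>-th roots of unity\<close>

context
  fixes n :: nat and U
  assumes n: "n > 0"
  defines "U \<equiv> unity_roots n"
begin

lemma sum_cayley: "(\<Sum>u\<in>U. cayley u) = 0"
  unfolding U_def using n by (intro sum_unity_roots_odd) (auto simp: cayley_inverse unity_roots_nonzero)

text \<open>The removed points are the poles of \<open>cayley u\<close> and
  \<open>cayley (u * \<xi>)\<close>, where the addition laws fail.\<close>

lemma sum_unity_roots_remove2:
  fixes f :: "complex \<Rightarrow> complex"
  assumes "\<xi> \<in> U" "\<xi> \<noteq> 1"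
  shows "(\<Sum>u\<in>U - {1, inverse \<xi>}. f u) = (\<Sum>u\<in>U. f u) - f 1 - f (inverse \<xi>)"
proof -
  have "\<xi> \<noteq> 0" using assms n U_def unity_roots_nonzero by blast
  with assms have "inverse \<xi> \<in> U" "inverse \<xi> \<noteq> 1"
    by (simp_all add: U_def unity_roots_inverse)
  moreover have "1 \<in> U" "finite U" using n finite_unity_roots by (simp_all add: U_def)
  ultimately show ?thesis
    by (subst sum_diff) auto
qed

text \<open>After the addition law, the full sums of \<open>cayley u\<close> and
  \<open>cayley (u * \<xi>)\<close> vanish; each of the two removed points contributes one
  \<open>(cayley \<xi>)\<^sup>2\<close>.\<close>

lemma sum_cayley_cayley:
  assumes "\<xi> \<in> U" "\<xi> \<noteq> 1"
  shows "(\<Sum>u\<in>U. cayley u * cayley (u * \<xi>)) = of_nat n - 2 + 2 * (cayley \<xi>)\<^sup>2"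
proof -
  have nz: "\<xi> \<noteq> 0" using assms n U_def unity_roots_nonzero by blast
  have "(\<Sum>u\<in>U. cayley u * cayley (u * \<xi>)) =
      (\<Sum>u\<in>U - {1, inverse \<xi>}. cayley u * cayley (u * \<xi>))"
    using nz by (subst sum_unity_roots_remove2[OF assms]) simp
  also have "\<dots> = (\<Sum>u\<in>U - {1, inverse \<xi>}. 1 + cayley \<xi> * (cayley u - cayley (u * \<xi>)))"
    using assms nz by (intro sum.cong refl cayley_times_cayley) (auto simp: field_simps)
  also have "\<dots> = of_nat n - 2 + 2 * (cayley \<xi>)\<^sup>2"
    unfolding sum_unity_roots_remove2[OF assms]
    using nz n sum_unity_roots_shift[OF n, of \<xi> cayley] assms sum_cayley
    by (simp add: sum.distrib sum_subtractf card_unity_roots cayley_inverse power2_eq_square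
        algebra_simps U_def flip: sum_distrib_left sum_distrib_right)
  finally show ?thesis .
qed

text \<open>Same method with \<open>koebe_times_cayley\<close>. Of the coefficient 3, two units come
  from the \<open>cayley\<close> differences at the removed points and one from
  \<open>koebe (inverse \<xi>)\<close>.\<close>

lemma sum_koebe_cayley_shift:
  assumes "\<xi> \<in> U"
  shows "(\<Sum>u\<in>U. koebe u * cayley (u * \<xi>)) =
    cayley \<xi> * (\<Sum>u\<in>U. koebe u) - 3 * koebe \<xi> * cayley \<xi>"
proof (cases "\<xi> = 1")
  case True
  have "(\<Sum>u\<in>U. koebe u * cayley u) = 0"
    unfolding U_def using n
    by (intro sum_unity_roots_odd) (auto simp: cayley_inverse koebe_inverse unity_roots_nonzero)
  with True show ?thesis by simp
next
  case False
  have nz: "\<xi> \<noteq> 0" using assms n U_def unity_roots_nonzero by blast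
  have "(\<Sum>u\<in>U. koebe u * cayley (u * \<xi>)) =
      (\<Sum>u\<in>U - {1, inverse \<xi>}. koebe u * cayley (u * \<xi>))"
    using nz by (subst sum_unity_roots_remove2[OF assms False]) simp
  also have "\<dots> = (\<Sum>u\<in>U - {1, inverse \<xi>}. koebe \<xi> * (cayley (u * \<xi>) - cayley u) + cayley \<xi> * koebe u)"
    using assms nz False by (intro sum.cong refl koebe_times_cayley) (auto simp: field_simps)
  also have "\<dots> = cayley \<xi> * (\<Sum>u\<in>U. koebe u) - 3 * koebe \<xi> * cayley \<xi>"
    unfolding sum_unity_roots_remove2[OF assms False]
    using nz n sum_unity_roots_shift[OF n, of \<xi> cayley] assms sum_cayley
    by (simp add: sum.distrib sum_subtractf card_unity_roots cayley_inverse koebe_inverse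
        algebra_simps U_def flip: sum_distrib_left sum_distrib_right)
  finally show ?thesis .
qed

lemma sum_weighted_cayley_correlation:
  fixes f :: "complex \<Rightarrow> complex"
  assumes "f 1 = 0" "coprime n k"
  shows "(\<Sum>v\<in>U. f v * (\<Sum>u\<in>U. cayley (u ^ k) * cayley ((u * v) ^ k))) =
    (of_nat n - 2) * (\<Sum>v\<in>U. f v) + 2 * (\<Sum>v\<in>U. f v * (cayley (v ^ k))\<^sup>2)"
proof -
  have "(\<Sum>v\<in>U. f v * (\<Sum>u\<in>U. cayley (u ^ k) * cayley ((u * v) ^ k))) =
      (\<Sum>v\<in>U. (of_nat n - 2) * f v + 2 * (f v * (cayley (v ^ k))\<^sup>2))"
  proof (intro sum.cong refl)
    fix v assume v: "v \<in> U"
    show "f v * (\<Sum>u\<in>U. cayley (u ^ k) * cayley ((u * v) ^ k)) =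
        (of_nat n - 2) * f v + 2 * (f v * (cayley (v ^ k))\<^sup>2)"
    proof (cases "v = 1")
      case True
      with assms show ?thesis by simp
    next
      case False
      then have vk: "v ^ k \<noteq> 1" "v ^ k \<in> U"
        using v unity_roots_coprime[OF assms(2), of v]
        by (auto simp: U_def unity_roots_power) (simp add: unity_roots_def)
      have "(\<Sum>u\<in>U. cayley (u ^ k) * cayley ((u * v) ^ k)) = (\<Sum>u\<in>U. cayley u * cayley (u * v ^ k))"
        using sum_unity_roots_power[OF n assms(2), of "\<lambda>u. cayley u * cayley (u * v ^ k)"]
        by (simp add: U_def power_mult_distrib)
      with sum_cayley_cayley[OF vk(2,1)] show ?thesis by (simp only:) (simp add: algebra_simps)
    qed
  qed
  thus ?thesis by (simp add: sum.distrib sum_distrib_left)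
qed

text \<open>The pointwise identity \<open>koebe_eq\<close> is available only at the
  \<open>n - 1\<close> roots other than 1; at 1 both summands are 0 by convention.\<close>

lemma sum_koebe_eq: "(\<Sum>u\<in>U. koebe u) = (\<Sum>u\<in>U. (cayley u)\<^sup>2) - (of_nat n - 1)"
proof -
  have U: "1 \<in> U" "finite U" "card U = n"
    using n by (simp_all add: U_def finite_unity_roots card_unity_roots)
  have "(\<Sum>u\<in>U. koebe u) = (\<Sum>u\<in>U - {1}. (cayley u)\<^sup>2 - 1)"
    using U by (subst sum.remove[of U 1]) (auto intro!: sum.cong koebe_eq)
  also have "\<dots> = (\<Sum>u\<in>U. (cayley u)\<^sup>2) - (of_nat n - 1)"
    using U n by (subst sum.remove[of U 1 "\<lambda>u. (cayley u)\<^sup>2"]) (auto simp: sum_subtractf of_nat_diff)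
  finally show ?thesis .
qed

text \<open>Here and in \<open>sum_koebe_cayley_sq\<close>, a double sum is evaluated in two orders, giving a linear
  equation for the unknown moment.\<close>

lemma sum_cayley_sq: "(\<Sum>u\<in>U. (cayley u)\<^sup>2) = - (of_nat n - 1) * (of_nat n - 2) / 3"
proof -
  have U: "1 \<in> U" "finite U" "card U = n"
    using n by (simp_all add: U_def finite_unity_roots card_unity_roots)
  \<comment> \<open>This weight is the constant 1 altered to vanish at 1, as the correlation lemma
    requires.\<close>
  let ?f = "\<lambda>v::complex. if v = 1 then 0 else 1 :: complex"
  have f: "(\<Sum>v\<in>U. ?f v * g v) = (\<Sum>v\<in>U. g v) - g 1" for g :: "complex \<Rightarrow> complex"
    using U by (simp add: sum.remove[of U 1])
  have "(\<Sum>v\<in>U. ?f v * (\<Sum>u\<in>U. cayley u * cayley (u * v))) = 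
      (of_nat n - 2) * (\<Sum>v\<in>U. ?f v * 1) + 2 * (\<Sum>v\<in>U. ?f v * (cayley v)\<^sup>2)"
    using sum_weighted_cayley_correlation[of ?f 1] by simp
  moreover have "(\<Sum>v\<in>U. \<Sum>u\<in>U. cayley u * cayley (u * v)) = 0"
  proof (subst sum.swap, rule sum.neutral, rule ballI)
    fix u assume "u \<in> U"
    then have "(\<Sum>v\<in>U. cayley (u * v)) = 0"
      using sum_unity_roots_shift[OF n, of u cayley] sum_cayley by (simp add: U_def mult.commute)
    thus "(\<Sum>v\<in>U. cayley u * cayley (u * v)) = 0" by (simp flip: sum_distrib_left)
  qed
  ultimately have "- (\<Sum>u\<in>U. (cayley u)\<^sup>2) = (of_nat n - 2) * (of_nat n - 1) + 2 * (\<Sum>u\<in>U. (cayley u)\<^sup>2)"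
    unfolding f using U(3) by (simp add: power2_eq_square)
  thus ?thesis by (simp add: field_simps)
qed

lemma sum_koebe: "(\<Sum>u\<in>U. koebe u) = - ((of_nat n)\<^sup>2 - 1) / 3"
  unfolding sum_koebe_eq sum_cayley_sq by (simp add: field_simps power2_eq_square)

lemma sum_koebe_cayley_sq:
  "(\<Sum>u\<in>U. koebe u * (cayley u)\<^sup>2) = ((of_nat n)\<^sup>2 - 1) * ((of_nat n)\<^sup>2 - 4) / 45"
proof -
  let ?S = "\<Sum>u\<in>U. koebe u * (cayley u)\<^sup>2"
  have "(\<Sum>v\<in>U. koebe v * (\<Sum>u\<in>U. cayley u * cayley (u * v))) =
      (of_nat n - 2) * (\<Sum>u\<in>U. koebe u) + 2 * ?S"
    using sum_weighted_cayley_correlation[of koebe 1] by simp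
  moreover have "(\<Sum>v\<in>U. koebe v * (\<Sum>u\<in>U. cayley u * cayley (u * v))) =
      (\<Sum>u\<in>U. cayley u * (\<Sum>v\<in>U. koebe v * cayley (v * u)))"
    unfolding sum_distrib_left by (subst sum.swap) (simp add: mult_ac)
  moreover have "\<dots> = (\<Sum>u\<in>U. koebe u) * (\<Sum>u\<in>U. (cayley u)\<^sup>2) - 3 * ?S"
  proof -
    have "(\<Sum>u\<in>U. cayley u * (\<Sum>v\<in>U. koebe v * cayley (v * u))) =
        (\<Sum>u\<in>U. (\<Sum>v\<in>U. koebe v) * (cayley u)\<^sup>2 - 3 * (koebe u * (cayley u)\<^sup>2))"
      by (intro sum.cong refl, subst sum_koebe_cayley_shift)
        (simp_all add: algebra_simps power2_eq_square)
    then show ?thesis by (simp add: sum_subtractf sum_distrib_left)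
  qed
  ultimately have "5 * ?S = (\<Sum>u\<in>U. koebe u) * (\<Sum>u\<in>U. (cayley u)\<^sup>2) - (of_nat n - 2) * (\<Sum>u\<in>U. koebe u)"
    by algebra
  thus ?thesis unfolding sum_koebe sum_cayley_sq by (simp add: field_simps power2_eq_square) algebra
qed

section \<open>Distribution relations\<close>

lemma unity_roots_mult_ne_1:
  assumes "x ^ n \<noteq> 1" "u \<in> U"
  shows "x * u \<noteq> 1"
  using assms power_mult_distrib[of x u n] by (auto simp: U_def unity_roots_def)

text \<open>There are fewer \<open>k\<close>-th than \<open>n\<close>-th roots, so some
  \<open>v\<close> has \<open>v ^ k \<noteq> 1\<close>; shifting by \<open>v\<close> multiplies the
  sum by \<open>v ^ k\<close>.\<close>

lemma sum_unity_roots_monomial: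
  assumes "0 < k" "k < n"
  shows "(\<Sum>u\<in>U. u ^ k) = 0"
proof -
  have "card (unity_roots k) < card (unity_roots n)"
    using assms by (simp add: card_unity_roots)
  then have "\<not> unity_roots n \<subseteq> unity_roots k"
    using card_mono finite_unity_roots[OF assms(1)] leD by blast
  then obtain v where v: "v \<in> unity_roots n" "v ^ k \<noteq> 1" by (auto simp: unity_roots_def)
  have "(\<Sum>u\<in>U. u ^ k) = v ^ k * (\<Sum>u\<in>U. u ^ k)"
    using sum_unity_roots_shift[OF n v(1), of "\<lambda>u. u ^ k"]
    by (simp add: U_def power_mult_distrib sum_distrib_left mult.commute)
  with v(2) show ?thesis by simp
qed

text \<open>Off the poles, \<open>1 / (1 - x * u)\<close> is a finite geometric sum over
  \<open>1 - x ^ n\<close>, and only its constant term survives summation over \<open>u\<close>. If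
  \<open>x ^ n = 1\<close>, both sides are 0.\<close>

lemma sum_cayley_mult:
  assumes "x \<noteq> 0"
  shows "(\<Sum>u\<in>U. cayley (x * u)) = of_nat n * cayley (x ^ n)"
proof (cases "x ^ n = 1")
  case True
  then have "x \<in> unity_roots n" by (simp add: unity_roots_def)
  then show ?thesis
    using sum_unity_roots_shift[OF n, of x cayley] sum_cayley True by (simp add: U_def mult.commute)
next
  case False
  note ne = unity_roots_mult_ne_1[OF False]
  have "(\<Sum>u\<in>U. 1 / (1 - x * u)) = (\<Sum>u\<in>U. (\<Sum>k<n. (x * u) ^ k) / (1 - x ^ n))"
  proof (intro sum.cong refl)
    fix u assume u: "u \<in> U"
    have "(\<Sum>k<n. (x * u) ^ k) = (1 - x ^ n) / (1 - x * u)"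
      using ne[OF u] u
      by (simp only: sum_gp_strict) (simp add: power_mult_distrib U_def unity_roots_def)
    thus "1 / (1 - x * u) = (\<Sum>k<n. (x * u) ^ k) / (1 - x ^ n)" using False by simp
  qed
  also have "\<dots> = (\<Sum>k<n. x ^ k * (\<Sum>u\<in>U. u ^ k)) / (1 - x ^ n)"
    unfolding sum_divide_distrib[symmetric] sum_distrib_left
    by (subst sum.swap) (simp add: power_mult_distrib)
  also have "(\<Sum>k<n. x ^ k * (\<Sum>u\<in>U. u ^ k)) = (\<Sum>k\<in>{0}. x ^ k * (\<Sum>u\<in>U. u ^ k))"
    using n by (intro sum.mono_neutral_right) (auto simp: sum_unity_roots_monomial)
  also have "\<dots> = of_nat n" using n by (simp add: U_def card_unity_roots)
  finally have *: "(\<Sum>u\<in>U. 1 / (1 - x * u)) = of_nat n / (1 - x ^ n)" .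
  have cay: "cayley y = 1 - 2 * (1 / (1 - y))" if "y \<noteq> 1" for y
    using that by (simp add: cayley_def divide_simps) (simp add: algebra_simps)
  have "(\<Sum>u\<in>U. cayley (x * u)) = (\<Sum>u\<in>U. 1 - 2 * (1 / (1 - x * u)))"
    by (intro sum.cong refl cay ne)
  also have "\<dots> = of_nat n - 2 * (of_nat n / (1 - x ^ n))"
    unfolding sum_subtractf sum_distrib_left[symmetric] * using n by (simp add: U_def card_unity_roots)
  also have "\<dots> = of_nat n * cayley (x ^ n)"
    unfolding cay[OF False] by (simp add: algebra_simps)
  finally show ?thesis .
qed

text \<open>Expand \<open>cayley (x ^ n)\<close> by the distribution relation and linearise each
  term with \<open>koebe_times_cayley\<close>. The term \<open>u = 1\<close> is split off, since the
  addition law excludes it.\<close>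

lemma koebe_times_cayley_power:
  assumes "x \<noteq> 0" "x ^ n \<noteq> 1"
  shows "of_nat n * koebe x * cayley (x ^ n) =
    koebe x * cayley x - (\<Sum>u\<in>U. koebe u) * cayley x + (\<Sum>u\<in>U. koebe u * cayley (x * u))"
proof -
  have U: "1 \<in> U" "finite U" using n by (simp_all add: U_def finite_unity_roots)
  have "of_nat n * koebe x * cayley (x ^ n) = (\<Sum>u\<in>U. koebe x * cayley (x * u))"
    using sum_cayley_mult[OF assms(1)] by (simp flip: sum_distrib_left)
  also have "\<dots> = koebe x * cayley x + (\<Sum>u\<in>U - {1}. koebe x * cayley (x * u))"
    using U by (simp add: sum.remove)
  also have "(\<Sum>u\<in>U - {1}. koebe x * cayley (x * u)) =
      (\<Sum>u\<in>U - {1}. koebe u * (cayley (x * u) - cayley x) + cayley u * koebe x)"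
  proof (intro sum.cong refl koebe_times_cayley)
    show "x \<noteq> 1" using assms by auto
  qed (use assms unity_roots_mult_ne_1 in auto)
  \<comment> \<open>The index 1 may be restored, because \<open>koebe 1\<close> and
    \<open>cayley 1\<close> are both 0.\<close>
  also have "\<dots> = (\<Sum>u\<in>U. koebe u * (cayley (x * u) - cayley x) + cayley u * koebe x)"
    using U by (simp add: sum.remove[of U 1])
  also have "\<dots> = (\<Sum>u\<in>U. koebe u * cayley (x * u)) - (\<Sum>u\<in>U. koebe u) * cayley x"
    using sum_cayley by (simp add: sum.distrib sum_subtractf algebra_simps flip: sum_distrib_left sum_distrib_right)
  finally show ?thesis by simp
qed

end

lemma has_field_derivative_cayley:
  assumes "x \<noteq> 1" "x \<noteq> 0"
  shows "(cayley has_field_derivative - koebe x / (2 * x)) (at x)"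
proof -
  have "((\<lambda>x. (x + 1) / (x - 1)) has_field_derivative - koebe x / (2 * x)) (at x)"
    using assms by (auto intro!: derivative_eq_intros simp: koebe_def divide_simps power2_eq_square)
  thus ?thesis by (simp add: cayley_def[abs_def])
qed

lemma has_field_derivative_koebe:
  assumes "x \<noteq> 1" "x \<noteq> 0"
  shows "(koebe has_field_derivative - koebe x * cayley x / x) (at x)"
proof -
  have "((\<lambda>x. 4 * x / (x - 1)\<^sup>2) has_field_derivative - koebe x * cayley x / x) (at x)"
    using assms by (auto intro!: derivative_eq_intros simp: koebe_def cayley_def divide_simps) algebra
  thus ?thesis by (simp add: koebe_def[abs_def])
qed

text \<open>Logarithmic differentiation of a distribution relation multiplies its right-hand side by \<open>n\<close>.\<close>

lemma distribution_relation_derivative: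
  fixes f f' :: "complex \<Rightarrow> complex" and c :: complex
  assumes n: "n > 0"
    and f: "\<And>x. x \<noteq> 0 \<Longrightarrow> x \<noteq> 1 \<Longrightarrow> (f has_field_derivative f' x / x) (at x)"
    and rel: "\<And>x. x \<noteq> 0 \<Longrightarrow> x ^ n \<noteq> 1 \<Longrightarrow> (\<Sum>u\<in>unity_roots n. f (x * u)) = c * f (x ^ n)"
    and x: "x \<noteq> 0" "x ^ n \<noteq> 1"
  shows "(\<Sum>u\<in>unity_roots n. f' (x * u)) = of_nat n * c * f' (x ^ n)"
proof -
  have 1: "((\<lambda>x. \<Sum>u\<in>unity_roots n. f (x * u)) has_field_derivative
      (\<Sum>u\<in>unity_roots n. f' (x * u) / (x * u) * u)) (at x)"
  proof (rule DERIV_sum)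
    fix u assume u: "u \<in> unity_roots n"
    have "x * u \<noteq> 0" "x * u \<noteq> 1"
      using x u unity_roots_nonzero[OF n u] unity_roots_mult_ne_1[OF n x(2)] by auto
    then show "((\<lambda>x. f (x * u)) has_field_derivative f' (x * u) / (x * u) * u) (at x)"
      using DERIV_chain2[OF f, of "\<lambda>x. x * u" x u UNIV] DERIV_cmult_right[OF DERIV_ident, of u x UNIV]
      by simp
  qed
  have "((\<lambda>x. f (x ^ n)) has_field_derivative f' (x ^ n) / x ^ n * (of_nat n * x ^ (n - 1))) (at x)"
  proof (rule DERIV_chain2[OF f])
    show "((\<lambda>x. x ^ n) has_field_derivative of_nat n * x ^ (n - 1)) (at x)"
      by (rule derivative_eq_intros refl)+ simp
  qed (use x in auto)
  from DERIV_cmult[OF this, of c]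
  have 2: "((\<lambda>x. c * f (x ^ n)) has_field_derivative
      c * (f' (x ^ n) / x ^ n * (of_nat n * x ^ (n - 1)))) (at x)" .
  \<comment> \<open>The relation is known only off the poles. That set is open, so both sides agree
    near \<open>x\<close> and have equal derivatives there.\<close>
  have "open {x::complex. x \<noteq> 0 \<and> x ^ n \<noteq> 1}"
    by (intro open_Collect_conj open_Collect_neq continuous_intros)
  then have "\<forall>\<^sub>F y in nhds x. y \<in> {x. x \<noteq> 0 \<and> x ^ n \<noteq> 1}"
    using x by (intro eventually_nhds_in_open) auto
  then have "\<forall>\<^sub>F y in nhds x. (\<Sum>u\<in>unity_roots n. f (y * u)) = c * f (y ^ n)"
    by eventually_elim (use rel in auto)
  from DERIV_cong_ev[OF refl this refl] 1 have "((\<lambda>x. c * f (x ^ n)) has_field_derivative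
      (\<Sum>u\<in>unity_roots n. f' (x * u) / (x * u) * u)) (at x)"
    by (rule iffD1)
  from DERIV_unique[OF this 2]
  have "x * (\<Sum>u\<in>unity_roots n. f' (x * u) / (x * u) * u) =
      c * f' (x ^ n) * of_nat n * (x * x ^ (n - 1) / x ^ n)" by simp
  moreover have "x * (\<Sum>u\<in>unity_roots n. f' (x * u) / (x * u) * u) = (\<Sum>u\<in>unity_roots n. f' (x * u))"
    unfolding sum_distrib_left using x unity_roots_nonzero[OF n] by (intro sum.cong) auto
  moreover have "x * x ^ (n - 1) / x ^ n = 1"
    using x n by (simp flip: power_Suc)
  ultimately have "(\<Sum>u\<in>unity_roots n. f' (x * u)) = c * f' (x ^ n) * of_nat n" by simp
  thus ?thesis by (simp add: mult_ac)
qed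

text \<open>The operator \<open>x * d/dx\<close> sends \<open>cayley\<close> to
  \<open>- koebe / 2\<close>, so this is the derivative of \<open>sum_cayley_mult\<close>.\<close>

lemma sum_koebe_mult:
  assumes "n > 0" "x \<noteq> 0" "x ^ n \<noteq> 1"
  shows "(\<Sum>u\<in>unity_roots n. koebe (x * u)) = of_nat n ^ 2 * koebe (x ^ n)"
  using distribution_relation_derivative[of n cayley "\<lambda>x. - koebe x / 2" "of_nat n" x]
    has_field_derivative_cayley sum_cayley_mult assms
  by (simp add: sum_negf power2_eq_square flip: sum_divide_distrib)

text \<open>One further derivative: \<open>x * d/dx\<close> sends \<open>koebe\<close> to
  \<open>- koebe * cayley\<close>.\<close>

lemma sum_koebe_cayley_mult:
  assumes "n > 0" "x \<noteq> 0" "x ^ n \<noteq> 1"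
  shows "(\<Sum>u\<in>unity_roots n. koebe (x * u) * cayley (x * u)) =
    of_nat n ^ 3 * (koebe (x ^ n) * cayley (x ^ n))"
  using distribution_relation_derivative[of n koebe "\<lambda>x. - koebe x * cayley x" "of_nat n ^ 2" x]
    has_field_derivative_koebe sum_koebe_mult assms
  by (simp add: sum_negf power2_eq_square power3_eq_cube)

section \<open>Reduction from \<open>p * q\<close>-th roots to \<open>p\<close>-th roots\<close>

text \<open>This is the inner sum over a coset of the \<open>q\<close>-th roots. Linearising at
  \<open>x = s * w\<close> leaves only sums over \<open>w\<close> that the distribution relations of
  order \<open>q\<close> evaluate.\<close>

lemma sum_koebe_cayley_power_coset:
  fixes p q :: nat
  assumes "p > 0" "q > 0" "coprime p q" "s \<in> unity_roots p" "s \<noteq> 1"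
  shows "of_nat p * (\<Sum>w\<in>unity_roots q. koebe (s * w) * cayley (w ^ p)) =
    of_nat q ^ 3 * koebe (s ^ q) * cayley (s ^ q) + 2 * koebe s * cayley s
    - (\<Sum>u\<in>unity_roots p. koebe u) * of_nat q * cayley (s ^ q)
    + of_nat q * (\<Sum>u\<in>unity_roots p. koebe u * cayley ((s * u) ^ q))"
proof -
  let ?P = "unity_roots p" and ?Q = "unity_roots q"
  let ?k = "\<Sum>u\<in>?P. koebe u"
  have Q: "1 \<in> ?Q" "finite ?Q" using assms by (simp_all add: finite_unity_roots)
  have s: "s \<noteq> 0" "s ^ p = 1" "s ^ q \<noteq> 1"
    using assms unity_roots_nonzero unity_roots_coprime[OF assms(3,4)] by (auto simp: unity_roots_def)
  have remove: "(\<Sum>w\<in>?Q - {1}. f w) = (\<Sum>w\<in>?Q. f w) - f 1" for f :: "complex \<Rightarrow> complex"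
    using sum.remove[OF Q(2,1), of f] by simp
  \<comment> \<open>The term \<open>w = 1\<close> is 0 and must be dropped, since there
    \<open>(s * w) ^ p = 1\<close>; elsewhere \<open>(s * w) ^ p = w ^ p\<close>.\<close>
  have "of_nat p * (\<Sum>w\<in>?Q. koebe (s * w) * cayley (w ^ p)) =
      (\<Sum>w\<in>?Q - {1}. of_nat p * koebe (s * w) * cayley ((s * w) ^ p))"
    using Q s by (simp add: sum.remove[of ?Q 1] sum_distrib_left power_mult_distrib mult_ac)
  also have "\<dots> = (\<Sum>w\<in>?Q - {1}. koebe (s * w) * cayley (s * w) - ?k * cayley (s * w)
      + (\<Sum>u\<in>?P. koebe u * cayley (s * w * u)))"
  proof (intro sum.cong refl koebe_times_cayley_power assms(1))
    fix w assume w: "w \<in> ?Q - {1}"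
    then show "s * w \<noteq> 0" using s(1) unity_roots_nonzero[OF assms(2)] by auto
    show "(s * w) ^ p \<noteq> 1"
      using w s unity_roots_coprime[OF assms(3), of w] by (auto simp: power_mult_distrib unity_roots_def)
  qed
  \<comment> \<open>Completing the sums to all \<open>w\<close> leaves three corrections at
    \<open>w = 1\<close>; by \<open>sum_koebe_cayley_shift\<close> they combine to
    \<open>2 * koebe s * cayley s\<close>.\<close>
  also have "\<dots> = (\<Sum>w\<in>?Q. koebe (s * w) * cayley (s * w)) - koebe s * cayley s
      - ?k * ((\<Sum>w\<in>?Q. cayley (s * w)) - cayley s)
      + ((\<Sum>u\<in>?P. koebe u * (\<Sum>w\<in>?Q. cayley (s * u * w))) - (\<Sum>u\<in>?P. koebe u * cayley (u * s)))"
  proof -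
    have "(\<Sum>w\<in>?Q. \<Sum>u\<in>?P. koebe u * cayley (s * w * u)) =
        (\<Sum>u\<in>?P. koebe u * (\<Sum>w\<in>?Q. cayley (s * u * w)))"
      unfolding sum_distrib_left by (subst sum.swap) (simp add: mult_ac)
    then show ?thesis
      unfolding remove by (simp add: sum.distrib sum_subtractf mult.commute[of s] algebra_simps flip: sum_distrib_left)
  qed
  also have "(\<Sum>u\<in>?P. koebe u * (\<Sum>w\<in>?Q. cayley (s * u * w))) =
      of_nat q * (\<Sum>u\<in>?P. koebe u * cayley ((s * u) ^ q))"
    unfolding sum_distrib_left[of "of_nat q"]
    using s(1) unity_roots_nonzero[OF assms(1)]
    by (intro sum.cong refl) (simp add: sum_cayley_mult[OF assms(2)])
  finally show ?thesis
    unfolding sum_koebe_cayley_shift[OF assms(1,4)] sum_cayley_mult[OF assms(2) s(1)]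
      sum_koebe_cayley_mult[OF assms(2) s(1,3)]
    by (simp add: algebra_simps)
qed

text \<open>With \<open>z = s * w\<close>, the factor \<open>cayley (z ^ q)\<close> depends on
  \<open>s\<close> alone and weights the coset sums. The resulting double sum over
  \<open>p\<close>-th roots is a weighted correlation.\<close>

lemma sum_koebe_cayley_cayley:
  fixes p q :: nat
  assumes "p > 0" "q > 0" "coprime p q"
  defines "P \<equiv> unity_roots p"
  shows "of_nat p * (\<Sum>z\<in>unity_roots (p * q). koebe z * cayley (z ^ p) * cayley (z ^ q)) =
    of_nat q ^ 3 * (\<Sum>u\<in>P. koebe u * (cayley u)\<^sup>2)
    + 2 * (\<Sum>u\<in>P. koebe u * cayley u * cayley (u ^ q))
    - of_nat q * (\<Sum>u\<in>P. koebe u) * (\<Sum>u\<in>P. (cayley u)\<^sup>2)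
    + of_nat q * ((of_nat p - 2) * (\<Sum>u\<in>P. koebe u) + 2 * (\<Sum>u\<in>P. koebe u * (cayley (u ^ q))\<^sup>2))"
proof -
  let ?Q = "unity_roots q"
  let ?k = "\<Sum>u\<in>P. koebe u"
  have "(\<Sum>z\<in>unity_roots (p * q). koebe z * cayley (z ^ p) * cayley (z ^ q)) =
      (\<Sum>(s, w)\<in>P \<times> ?Q. koebe (s * w) * cayley ((s * w) ^ p) * cayley ((s * w) ^ q))"
    using sum.reindex_bij_betw[OF bij_betw_unity_roots_mult[OF assms(1-3)],
        of "\<lambda>z. koebe z * cayley (z ^ p) * cayley (z ^ q)"]
    by (simp add: P_def case_prod_unfold)
  also have "\<dots> = (\<Sum>s\<in>P. \<Sum>w\<in>?Q. koebe (s * w) * cayley ((s * w) ^ p) * cayley ((s * w) ^ q))"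
    by (simp add: sum.cartesian_product)
  also have "\<dots> = (\<Sum>s\<in>P. cayley (s ^ q) * (\<Sum>w\<in>?Q. koebe (s * w) * cayley (w ^ p)))"
    unfolding sum_distrib_left
    by (intro sum.cong refl) (simp add: P_def unity_roots_def power_mult_distrib)
  finally have "of_nat p * (\<Sum>z\<in>unity_roots (p * q). koebe z * cayley (z ^ p) * cayley (z ^ q)) =
      (\<Sum>s\<in>P. cayley (s ^ q) * (of_nat p * (\<Sum>w\<in>?Q. koebe (s * w) * cayley (w ^ p))))"
    by (simp add: sum_distrib_left mult_ac)
  also have "\<dots> = (\<Sum>s\<in>P. cayley (s ^ q) * (of_nat q ^ 3 * koebe (s ^ q) * cayley (s ^ q)
      + 2 * koebe s * cayley s - ?k * of_nat q * cayley (s ^ q)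
      + of_nat q * (\<Sum>u\<in>P. koebe u * cayley ((s * u) ^ q))))"
  proof (intro sum.cong refl)
    fix s assume "s \<in> P"
    then show "cayley (s ^ q) * (of_nat p * (\<Sum>w\<in>?Q. koebe (s * w) * cayley (w ^ p))) =
      cayley (s ^ q) * (of_nat q ^ 3 * koebe (s ^ q) * cayley (s ^ q)
      + 2 * koebe s * cayley s - ?k * of_nat q * cayley (s ^ q)
      + of_nat q * (\<Sum>u\<in>P. koebe u * cayley ((s * u) ^ q)))"
      by (cases "s = 1") (simp_all add: P_def sum_koebe_cayley_power_coset[OF assms(1-3)])
  qed
  also have "\<dots> = of_nat q ^ 3 * (\<Sum>s\<in>P. koebe (s ^ q) * (cayley (s ^ q))\<^sup>2)
    + 2 * (\<Sum>s\<in>P. koebe s * cayley s * cayley (s ^ q))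
    - of_nat q * ?k * (\<Sum>s\<in>P. (cayley (s ^ q))\<^sup>2)
    + of_nat q * (\<Sum>s\<in>P. \<Sum>u\<in>P. koebe u * (cayley (s ^ q) * cayley ((s * u) ^ q)))"
  proof -
    have "cayley (s ^ q) * (of_nat q ^ 3 * koebe (s ^ q) * cayley (s ^ q)
        + 2 * koebe s * cayley s - k * of_nat q * cayley (s ^ q) + of_nat q * r) =
      of_nat q ^ 3 * (koebe (s ^ q) * (cayley (s ^ q))\<^sup>2)
        + 2 * (koebe s * cayley s * cayley (s ^ q))
        - of_nat q * k * (cayley (s ^ q))\<^sup>2 + of_nat q * (cayley (s ^ q) * r)" for s k r
      by algebra
    then show ?thesis
      by (simp only: sum.distrib sum_subtractf flip: sum_distrib_left)
        (simp add: sum_distrib_left mult_ac)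
  qed
  also have "(\<Sum>s\<in>P. \<Sum>u\<in>P. koebe u * (cayley (s ^ q) * cayley ((s * u) ^ q))) =
      (\<Sum>u\<in>P. koebe u * (\<Sum>s\<in>P. cayley (s ^ q) * cayley ((s * u) ^ q)))"
    unfolding sum_distrib_left by (rule sum.swap)
  also have "\<dots> = (of_nat p - 2) * ?k + 2 * (\<Sum>u\<in>P. koebe u * (cayley (u ^ q))\<^sup>2)"
    unfolding P_def by (rule sum_weighted_cayley_correlation) (use assms in simp_all)
  also have "(\<Sum>s\<in>P. koebe (s ^ q) * (cayley (s ^ q))\<^sup>2) = (\<Sum>s\<in>P. koebe s * (cayley s)\<^sup>2)"
    unfolding P_def using assms by (intro sum_unity_roots_power)
  also have "(\<Sum>s\<in>P. (cayley (s ^ q))\<^sup>2) = (\<Sum>s\<in>P. (cayley s)\<^sup>2)"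
    unfolding P_def using assms by (intro sum_unity_roots_power)
  finally show ?thesis .
qed

section \<open>The two rational sums in terms of \<open>koebe\<close> and
  \<open>cayley\<close>\<close>

lemma sum_koebe_cayley_power:
  assumes "n > 0"
  shows "(\<Sum>u\<in>unity_roots n. koebe u * cayley (u ^ k)) = 0"
  using assms unity_roots_nonzero[OF assms]
  by (intro sum_unity_roots_odd) (auto simp: koebe_inverse power_inverse cayley_inverse)

text \<open>Away from \<open>u = 1\<close> the summand is
  \<open>2 * koebe u * (cayley u - 1) * (cayley (u ^ q) - 1)\<close>; the terms with a single
  \<open>cayley\<close> factor are odd and cancel.\<close>

lemma sum_rational_cubic:
  fixes p q :: nat
  assumes "p > 0" "coprime p q"
  defines "P \<equiv> unity_roots p"
  shows "32 * (\<Sum>u\<in>P. u / ((u - 1) ^ 3 * (u ^ q - 1))) =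
    2 * (\<Sum>u\<in>P. koebe u * cayley u * cayley (u ^ q)) + 2 * (\<Sum>u\<in>P. koebe u)"
proof -
  have "32 * (\<Sum>u\<in>P. u / ((u - 1) ^ 3 * (u ^ q - 1))) =
      (\<Sum>u\<in>P. 2 * (koebe u * cayley u * cayley (u ^ q)) - 2 * (koebe u * cayley (u ^ 1))
        - 2 * (koebe u * cayley (u ^ q)) + 2 * koebe u)"
    unfolding sum_distrib_left
  proof (intro sum.cong refl)
    fix u assume "u \<in> P"
    then have "u = 1 \<or> u \<noteq> 1 \<and> u ^ q \<noteq> 1"
      using unity_roots_coprime[OF assms(2), of u] by (auto simp: P_def unity_roots_def)
    then show "32 * (u / ((u - 1) ^ 3 * (u ^ q - 1))) =
        2 * (koebe u * cayley u * cayley (u ^ q)) - 2 * (koebe u * cayley (u ^ 1))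
        - 2 * (koebe u * cayley (u ^ q)) + 2 * koebe u"
    proof (elim disjE conjE)
      assume ne: "u \<noteq> 1" "u ^ q \<noteq> 1"
      define a b where "a = 1 / (u - 1)" and "b = 1 / (u ^ q - 1)"
      have *: "cayley u = 1 + 2 * a" "cayley (u ^ q) = 1 + 2 * b" "koebe u = 4 * u * a\<^sup>2"
        "u / ((u - 1) ^ 3 * (u ^ q - 1)) = u * a ^ 3 * b"
        unfolding a_def b_def cayley_eq[OF ne(1)] cayley_eq[OF ne(2)] koebe_eq_inverse
        by (simp_all add: power_divide)
      show ?thesis
        unfolding power_one_right * by algebra
    qed auto
  qed
  also have "\<dots> = 2 * (\<Sum>u\<in>P. koebe u * cayley u * cayley (u ^ q)) + 2 * (\<Sum>u\<in>P. koebe u)"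
    unfolding sum.distrib sum_subtractf sum_distrib_left[symmetric] P_def
      sum_koebe_cayley_power[OF assms(1)] by simp
  finally show ?thesis .
qed

text \<open>Here the summand is \<open>2 * koebe u * (cayley (u ^ q) - 1)\<^sup>2\<close>, whose
  cross term is odd.\<close>

lemma sum_rational_quadratic:
  fixes p q :: nat
  assumes "p > 0" "coprime p q"
  defines "P \<equiv> unity_roots p"
  shows "32 * (\<Sum>u\<in>P. u / ((u - 1) ^ 2 * (u ^ q - 1) ^ 2)) =
    2 * (\<Sum>u\<in>P. koebe u * (cayley (u ^ q))\<^sup>2) + 2 * (\<Sum>u\<in>P. koebe u)"
proof -
  have "32 * (\<Sum>u\<in>P. u / ((u - 1) ^ 2 * (u ^ q - 1) ^ 2)) =
      (\<Sum>u\<in>P. 2 * (koebe u * (cayley (u ^ q))\<^sup>2) - 4 * (koebe u * cayley (u ^ q)) + 2 * koebe u)"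
    unfolding sum_distrib_left
  proof (intro sum.cong refl)
    fix u assume "u \<in> P"
    then have "u = 1 \<or> u \<noteq> 1 \<and> u ^ q \<noteq> 1"
      using unity_roots_coprime[OF assms(2), of u] by (auto simp: P_def unity_roots_def)
    then show "32 * (u / ((u - 1) ^ 2 * (u ^ q - 1) ^ 2)) =
        2 * (koebe u * (cayley (u ^ q))\<^sup>2) - 4 * (koebe u * cayley (u ^ q)) + 2 * koebe u"
    proof (elim disjE conjE)
      assume ne: "u \<noteq> 1" "u ^ q \<noteq> 1"
      define a b where "a = 1 / (u - 1)" and "b = 1 / (u ^ q - 1)"
      have *: "cayley (u ^ q) = 1 + 2 * b" "koebe u = 4 * u * a\<^sup>2"
        "u / ((u - 1) ^ 2 * (u ^ q - 1) ^ 2) = u * a ^ 2 * b ^ 2"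
        unfolding a_def b_def cayley_eq[OF ne(1)] cayley_eq[OF ne(2)] koebe_eq_inverse
        by (simp_all add: power_divide)
      show ?thesis
        unfolding * by algebra
    qed auto
  qed
  also have "\<dots> = 2 * (\<Sum>u\<in>P. koebe u * (cayley (u ^ q))\<^sup>2) + 2 * (\<Sum>u\<in>P. koebe u)"
    unfolding sum.distrib sum_subtractf sum_distrib_left[symmetric] P_def
      sum_koebe_cayley_power[OF assms(1)] by simp
  finally show ?thesis .
qed

section \<open>Trigonometric form and conclusion\<close>

lemma sum_cis_eq_sum_unity_roots:
  assumes "n > 0"
  shows "(\<Sum>k<n. f (cis (2 * pi * real k / real n))) = (\<Sum>u\<in>unity_roots n. f u)"
  unfolding unity_roots_def
  by (rule sum.reindex_bij_betw[OF Complex.bij_betw_roots_unity[OF assms]])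

text \<open>The exponents cross over: \<open>z ^ q\<close> has half-angle \<open>pi * n / p\<close>.
  The signs cancel, as \<open>\<i> * \<i> * (-1) = 1\<close>, and the excluded indices contribute 0
  because \<open>cayley 1 = 0\<close>.\<close>

lemma sum_cot_cot_sin:
  fixes p q :: nat
  assumes "p > 0" "q > 0"
  shows "complex_of_real
      (\<Sum>n\<in>{n. 1 \<le> n \<and> n \<le> p * q - 1 \<and> \<not> p dvd n \<and> \<not> q dvd n}.
          cot (pi * real n / real p) * cot (pi * real n / real q)
            / (sin (pi * real n / real (p * q)))\<^sup>2)
    = (\<Sum>z\<in>unity_roots (p * q). koebe z * cayley (z ^ p) * cayley (z ^ q))"
    (is "complex_of_real (sum ?f ?A) = sum ?g _")
proof -
  let ?z = "\<lambda>n. cis (2 * pi * real n / real (p * q))"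
  have zq: "?z n ^ q = cis (2 * (pi * real n / real p))"
    and zp: "?z n ^ p = cis (2 * (pi * real n / real q))" for n
    unfolding Complex.DeMoivre using assms by (simp_all add: mult_ac)
  have fg: "complex_of_real (?f n) = ?g (?z n)" for n
  proof -
    have "complex_of_real (?f n) =
        (\<i> * cayley (?z n ^ q)) * (\<i> * cayley (?z n ^ p)) * (- koebe (?z n))"
      using koebe_cis[of "pi * real n / real (p * q)"]
      unfolding zq zp cayley_cis by (simp add: mult.assoc)
    thus ?thesis by (simp add: mult_ac)
  qed
  have one: "cis (2 * (pi * real n / real m)) = 1" if "m dvd n" for m n :: nat
  proof -
    from that obtain k where "n = m * k" by blast
    then show ?thesis using cis_multiple_2pi[of "real k"] by (cases "m = 0") (auto simp: mult_ac)
  qed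
  have "complex_of_real (sum ?f ?A) = (\<Sum>n\<in>?A. ?g (?z n))"
    unfolding of_real_sum fg ..
  also have "\<dots> = (\<Sum>n<p * q. ?g (?z n))"
  proof (rule sum.mono_neutral_left)
    show "?A \<subseteq> {..<p * q}" using assms by auto
    show "\<forall>n\<in>{..<p * q} - ?A. ?g (?z n) = 0"
    proof
      fix n assume "n \<in> {..<p * q} - ?A"
      then have "p dvd n \<or> q dvd n" by (cases "n = 0") auto
      then show "?g (?z n) = 0" unfolding zq zp using one[of p n] one[of q n] by auto
    qed
  qed simp
  also have "\<dots> = (\<Sum>z\<in>unity_roots (p * q). ?g z)"
    using assms by (intro sum_cis_eq_sum_unity_roots) simp
  finally show ?thesis .
qed

theorem mainTheorem11:
  fixes p q :: nat
  assumes "p \<ge> 2" and "q \<ge> 2" and "coprime p q"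
  defines "\<omega> \<equiv> (\<lambda>j::nat. cis (2 * pi * real j / real p))"
  shows "complex_of_real
      (\<Sum>n\<in>{n. 1 \<le> n \<and> n \<le> p * q - 1 \<and> \<not> p dvd n \<and> \<not> q dvd n}.
          cot (pi * real n / real p) * cot (pi * real n / real q)
            / (sin (pi * real n / real (p * q)))\<^sup>2)
    = complex_of_real
        ((real p ^ 4 * real q ^ 3 - 5 * real p ^ 4 * real q + 4 * real q ^ 3
          - 5 * real p ^ 2 * real q ^ 3 + 55 * real p ^ 2 * real q + 30 * real p ^ 2
          - 50 * real q - 30) / (45 * real p))
      + 32 / of_nat p * (\<Sum>j=1..p-1. \<omega> j / ((\<omega> j - 1) ^ 3 * (\<omega> j ^ q - 1)))
      + 32 * of_nat q / of_nat p
          * (\<Sum>j=1..p-1. \<omega> j / ((\<omega> j - 1) ^ 2 * (\<omega> j ^ q - 1) ^ 2))"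
proof -
  let ?P = "unity_roots p"
  have pos: "p > 0" "q > 0" using assms by auto
  \<comment> \<open>The index \<open>j = 0\<close> can be added since \<open>\<omega> 0 = 1\<close>;
    the summands of the theorem vanish at 1 through division by zero.\<close>
  have P: "(\<Sum>j=1..p-1. f (\<omega> j)) = (\<Sum>u\<in>?P. f u)" if "f 1 = 0" for f :: "complex \<Rightarrow> complex"
  proof -
    have "(\<Sum>j=1..p-1. f (\<omega> j)) = (\<Sum>j<p. f (\<omega> j))"
      by (rule sum.mono_neutral_left) (use pos that in \<open>auto simp: \<omega>_def Suc_le_eq\<close>)
    then show ?thesis unfolding \<omega>_def using sum_cis_eq_sum_unity_roots[OF pos(1)] by simp
  qed
  define A where "A = (\<Sum>u\<in>?P. u / ((u - 1) ^ 3 * (u ^ q - 1)))"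
  define B where "B = (\<Sum>u\<in>?P. u / ((u - 1) ^ 2 * (u ^ q - 1) ^ 2))"
  define S where "S = (\<Sum>z\<in>unity_roots (p * q). koebe z * cayley (z ^ p) * cayley (z ^ q))"
  define X Y where "X = (of_nat p :: complex)" and "Y = (of_nat q :: complex)"
  have X: "X \<noteq> 0" using pos by (simp add: X_def)
  \<comment> \<open>The rational term is \<open>-2\<close> times the value of
    \<open>sum_koebe\<close>.\<close>
  have A: "2 * (\<Sum>u\<in>?P. koebe u * cayley u * cayley (u ^ q)) = 32 * A + 2 * (X\<^sup>2 - 1) / 3"
    using sum_rational_cubic[OF pos(1) assms(3)] unfolding sum_koebe[OF pos(1)] A_def X_def
    by (simp add: field_simps)
  have B: "2 * (\<Sum>u\<in>?P. koebe u * (cayley (u ^ q))\<^sup>2) = 32 * B + 2 * (X\<^sup>2 - 1) / 3"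
    using sum_rational_quadratic[OF pos(1) assms(3)] unfolding sum_koebe[OF pos(1)] B_def X_def
    by (simp add: field_simps)
  \<comment> \<open>Apart from \<open>A\<close> and \<open>B\<close>, every sum now has a closed
    form in \<open>X\<close>, so only polynomial arithmetic remains.\<close>
  have "X * S = (X ^ 4 * Y ^ 3 - 5 * X ^ 4 * Y + 4 * Y ^ 3 - 5 * X ^ 2 * Y ^ 3 + 55 * X ^ 2 * Y
      + 30 * X ^ 2 - 50 * Y - 30) / 45 + 32 * A + 32 * Y * B"
    unfolding X_def S_def sum_koebe_cayley_cayley[OF pos assms(3)]
    unfolding A B unfolding sum_koebe[OF pos(1)] sum_koebe_cayley_sq[OF pos(1)] sum_cayley_sq[OF pos(1)]
    unfolding X_def[symmetric] Y_def[symmetric]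
    by (simp add: field_simps power2_eq_square power3_eq_cube power4_eq_xxxx)
  then have "S = (X ^ 4 * Y ^ 3 - 5 * X ^ 4 * Y + 4 * Y ^ 3 - 5 * X ^ 2 * Y ^ 3 + 55 * X ^ 2 * Y
      + 30 * X ^ 2 - 50 * Y - 30) / (45 * X) + 32 / X * A + 32 * Y / X * B"
    using X by (simp add: field_simps)
  moreover have "(\<Sum>j=1..p-1. \<omega> j / ((\<omega> j - 1) ^ 3 * (\<omega> j ^ q - 1))) = A"
    unfolding A_def by (rule P) simp
  moreover have "(\<Sum>j=1..p-1. \<omega> j / ((\<omega> j - 1) ^ 2 * (\<omega> j ^ q - 1) ^ 2)) = B"
    unfolding B_def by (rule P) simp
  ultimately show ?thesis
    unfolding sum_cot_cot_sin[OF pos] S_def[symmetric] by (simp add: X_def Y_def)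
qed

end
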